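(* For every integer $j\geq3$, the minimum abelian period of the finite Fibonacci word $f_j$ is the Fibonacci number $F_n$, where $$n=\begin{cases}\lfloor j/2\rfloor & \text{if } j\equiv 0,1,2\pmod 4,\\ \lfloor j/2\rfloor+1 & \text{if } j\equiv3\pmod 4.\end{cases}$$
   Context: Fibonacci numbers: $F_0=1$, $F_1=1$, $F_{j+1}=F_j+F_{j-1}$ for $j\geq1$. The finite Fibonacci words over $\{a,b\}$ are $f_0=b$, $f_1=a$, $f_j=f_{j-1}f_{j-2}$ for $j>1$; $|f_j|=F_j$. The Parikh vector $\mathcal P$ of a word over $\{a,b\}$ is the pair (number of $a$'s, number of $b$'s), with norm $|\mathcal P|$ the sum of its components; $\mathcal P$ is contained in $\mathcal Q$ if $|\mathcal P|<|\mathcal Q|$ and $\mathcal P\leq\mathcal Q$ componentwise. An integer $m$ is an abelian period of a word $w$ if $w=u_0u_1\cdots u_{j-1}u_j$ for some $j\geq2$, where $u_1,\dots,u_{j-1}$ all have the same Parikh vector $\mathcal P$ of norm $m$, and the Parikh vectors of $u_0$ and $u_j$ (possibly empty words) are contained in $\mathcal P$. The minimum abelian period of $w$ is the smallest such $m$. *)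

theory Defs
  imports "HOL-Number_Theory.Fib"
begin

(* The sequence is indexed so that F 0 = F 1 = 1, whereas the library has fib 0 = 0, fib 1 = 1. *)
definition F :: "nat \<Rightarrow> nat" where
  "F j = fib (Suc j)"

lemma F_rec: "F 0 = 1" "F 1 = 1" "j \<ge> 1 \<Longrightarrow> F (j + 1) = F j + F (j - 1)"
  by (cases j; simp add: F_def)+

datatype letter = a | b

type_synonym word = "letter list"

fun fib_word :: "nat \<Rightarrow> word" where
  "fib_word 0 = [b]"
| "fib_word (Suc 0) = [a]"
| "fib_word (Suc (Suc j)) = fib_word (Suc j) @ fib_word j"

lemma length_fib_word: "length (fib_word j) = F j"
  by (induction j rule: fib_word.induct) (simp_all add: F_def)

definition parikh :: "word \<Rightarrow> nat \<times> nat" where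
  "parikh w = (count_list w a, count_list w b)"

definition parikh_norm :: "nat \<times> nat \<Rightarrow> nat" where
  "parikh_norm P = fst P + snd P"

definition parikh_contained :: "nat \<times> nat \<Rightarrow> nat \<times> nat \<Rightarrow> bool" where
  "parikh_contained P Q \<longleftrightarrow>
     parikh_norm P < parikh_norm Q \<and> fst P \<le> fst Q \<and> snd P \<le> snd Q"

(* The factors of the decomposition are u 0, ..., u k; since k \<ge> 2, at least one block u 1 with
   Parikh vector exactly P occurs. Periods are norms of Parikh vectors, so natural numbers suffice;
   m = 0 is excluded because containment of the Parikh vector of u 0 in P is strict in norm. *)
definition abelian_period :: "word \<Rightarrow> nat \<Rightarrow> bool" where
  "abelian_period w m \<longleftrightarrow>
     (\<exists>(k::nat) (u :: nat \<Rightarrow> word) (P :: nat \<times> nat).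
        k \<ge> 2 \<and> w = concat (map u [0..<Suc k]) \<and>
        (\<forall>i\<in>{1..k - 1}. parikh (u i) = P) \<and> parikh_norm P = m \<and>
        parikh_contained (parikh (u 0)) P \<and> parikh_contained (parikh (u k)) P)"

definition is_min_abelian_period :: "word \<Rightarrow> nat \<Rightarrow> bool" where
  "is_min_abelian_period w m \<longleftrightarrow>
     abelian_period w m \<and> (\<forall>m'. abelian_period w m' \<longrightarrow> m \<le> m')"

end

theory Submission
  imports Complex_Main Defs
begin

text \<open>Let \<open>\<theta> = (sqrt 5 - 1) / 2\<close>. The prefix of length \<open>i\<close> of a Fibonacci word contains
  \<open>\<lfloor>(i + 1) \<theta>\<rfloor>\<close> letters \<open>a\<close>, so an abelian repetition with period \<open>m\<close>, \<open>K\<close> full blocks and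
  \<open>p\<close> letters \<open>a\<close> per block forces \<open>K * \<bar>m \<theta> - p\<bar> < 1\<close>. For \<open>m < F n\<close> the distance
  \<open>\<bar>m \<theta> - p\<bar>\<close> is at least \<open>\<theta> ^ (n - 2)\<close> unless \<open>m\<close> is \<open>F (n - 1)\<close> or \<open>F (n - 2)\<close>, which bounds
  the length of the repetition by less than \<open>F j\<close>. In the tight case \<open>m = F (n - 1)\<close> one uses in
  addition that the head, being shorter than \<open>m\<close>, keeps the starting point \<open>(h + 1) \<theta>\<close> at distance
  at least \<open>\<theta> ^ n\<close> from the integers, and the sign of \<open>L n - 1 / \<theta> ^ n\<close>, with \<open>L n\<close> the Lucas
  number, yields the dependence on \<open>j\<close> modulo 4. Conversely, a head of length
  \<open>F n - 1\<close> realises the period \<open>F n\<close>.\<close>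

section \<open>Powers of \<theta> and Fibonacci numbers\<close>

definition \<theta> :: real where
  "\<theta> = (sqrt 5 - 1) / 2"

lemma theta_square: "\<theta> * \<theta> = 1 - \<theta>"
  by (simp add: \<theta>_def field_simps)

lemma theta_bounds: "1/2 < \<theta>" "\<theta> < 2/3"
proof -
  have "2 < sqrt 5" "sqrt 5 < 7/3"
    by (rule real_less_rsqrt real_less_lsqrt; simp add: power2_eq_square)+
  then show "1/2 < \<theta>" "\<theta> < 2/3"
    by (auto simp: \<theta>_def)
qed

lemma theta_power_rec: "\<theta> ^ Suc (Suc i) = \<theta> ^ i - \<theta> ^ Suc i"
proof -
  have "\<theta> ^ Suc (Suc i) = (\<theta> * \<theta>) * \<theta> ^ i" by simp
  also have "\<dots> = \<theta> ^ i - \<theta> ^ Suc i" unfolding theta_square by (simp add: algebra_simps)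
  finally show ?thesis .
qed

lemma theta_power_pos: "0 < \<theta> ^ i"
  using theta_bounds by simp

lemma theta_power_antimono: "i \<le> k \<Longrightarrow> \<theta> ^ k \<le> \<theta> ^ i"
  using theta_bounds by (intro power_decreasing) auto

lemma fib_pos_Suc: "0 < fib (Suc i)"
  by (simp add: fib_neq_0_nat)

text \<open>Both sides satisfy the Fibonacci recurrence, since \<open>- \<theta>\<close> is a root
  of \<open>x^2 = x + 1\<close>. This is the error of a convergent of \<theta>, with alternating
  sign.\<close>

lemma fib_mult_theta: "real (fib (Suc i)) * \<theta> - real (fib i) = (- 1) ^ i * \<theta> ^ Suc i"
proof (induction i rule: fib.induct)
  case 2
  then show ?case using theta_square by simp
next
  case (3 i)
  have "real (fib (Suc (Suc (Suc i)))) * \<theta> - real (fib (Suc (Suc i)))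
      = (real (fib (Suc (Suc i))) * \<theta> - real (fib (Suc i)))
        + (real (fib (Suc i)) * \<theta> - real (fib i))"
    by (simp add: algebra_simps)
  also have "\<dots> = (- 1) ^ i * (\<theta> ^ Suc i - \<theta> ^ Suc (Suc i))"
    unfolding 3 by (simp add: algebra_simps)
  also have "\<theta> ^ Suc i - \<theta> ^ Suc (Suc i) = \<theta> ^ Suc (Suc (Suc i))"
    using theta_power_rec[of "Suc i"] by linarith
  finally show ?case by simp
qed simp

lemma abs_fib_mult_theta: "\<bar>real (fib (Suc i)) * \<theta> - real (fib i)\<bar> = \<theta> ^ Suc i"
  unfolding fib_mult_theta abs_mult power_abs using theta_bounds by simp

text \<open>Passing from \<open>i\<close> to \<open>i + 1\<close> leaves the sum unchanged, by
  \<open>theta_power_rec\<close>. Two bounds follow, which place \<open>1 / \<theta> ^ i\<close>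
  between \<open>fib (i + 1)\<close> and \<open>fib (i + 2)\<close>.\<close>

lemma fib_theta_partition: "real (fib (Suc i)) * \<theta> ^ i + real (fib i) * \<theta> ^ Suc i = 1"
proof (induction i)
  case (Suc i)
  have "real (fib (Suc (Suc i))) * \<theta> ^ Suc i + real (fib (Suc i)) * \<theta> ^ Suc (Suc i)
      = real (fib (Suc i)) * \<theta> ^ i + real (fib i) * \<theta> ^ Suc i"
    unfolding theta_power_rec by (simp add: algebra_simps)
  with Suc show ?case by simp
qed simp

lemma fib_theta_power_less:
  assumes "0 < i"
  shows "real (fib (Suc i)) * \<theta> ^ i < 1"
proof -
  have "0 < real (fib i) * \<theta> ^ Suc i"
    using assms theta_power_pos[of "Suc i"] by (simp add: fib_neq_0_nat)
  with fib_theta_partition[of i] show ?thesis by linarith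
qed

lemma fib_theta_power_ge: "1 \<le> real (fib (Suc (Suc i))) * \<theta> ^ i"
proof -
  have "real (fib i) * \<theta> ^ Suc i \<le> real (fib i) * \<theta> ^ i"
    by (intro mult_left_mono theta_power_antimono) auto
  with fib_theta_partition[of i] show ?thesis by (simp add: algebra_simps)
qed

text \<open>The first factor is the Lucas number \<open>L k\<close> with \<open>k = i + 1\<close>,
  and \<open>L k = 1 / \<theta> ^ k + (- \<theta>) ^ k\<close>. Hence \<open>L k\<close> exceeds
  \<open>1 / \<theta> ^ k\<close> exactly when \<open>k\<close> is even.\<close>

lemma lucas_theta_power:
  "real (fib i + fib (Suc (Suc i))) * \<theta> ^ Suc i = 1 - (- 1) ^ i * (\<theta> ^ Suc i) ^ 2"
proof -
  have "real (fib i + fib (Suc (Suc i))) * \<theta> ^ Suc i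
      = (real (fib (Suc i)) * \<theta> ^ i + real (fib i) * \<theta> ^ Suc i)
        + real (fib (Suc i)) * (\<theta> ^ Suc i - \<theta> ^ i) + real (fib i) * \<theta> ^ Suc i"
    by (simp add: algebra_simps)
  also have "\<theta> ^ Suc i - \<theta> ^ i = - (\<theta> ^ Suc i * \<theta>)"
    using theta_power_rec[of i] by (simp add: algebra_simps)
  also have "(real (fib (Suc i)) * \<theta> ^ i + real (fib i) * \<theta> ^ Suc i)
        + real (fib (Suc i)) * - (\<theta> ^ Suc i * \<theta>) + real (fib i) * \<theta> ^ Suc i
      = 1 - \<theta> ^ Suc i * (real (fib (Suc i)) * \<theta> - real (fib i))"
    unfolding fib_theta_partition by (simp add: algebra_simps)
  finally show ?thesis
    unfolding fib_mult_theta by (simp add: power2_eq_square algebra_simps)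
qed

section \<open>Rational approximation of \<theta>\<close>

text \<open>Consecutive convergents form a basis of the integer lattice; the step is a unimodular
  change of basis. The difference of Fibonacci numbers stands for \<open>fib (i - 1)\<close>, so
  that \<open>i = 0\<close> is covered.\<close>

lemma fib_lattice:
  "\<exists>x y :: int. m = x * int (fib (Suc i)) + y * int (fib i)
    \<and> p = x * int (fib i) + y * (int (fib (Suc i)) - int (fib i))"
proof (induction i)
  case 0
  show ?case by (rule exI[of _ m], rule exI[of _ p]) simp
next
  case (Suc i)
  then obtain x y where xy: "m = x * int (fib (Suc i)) + y * int (fib i)"
    "p = x * int (fib i) + y * (int (fib (Suc i)) - int (fib i))"
    by blast
  show ?case
    by (rule exI[of _ y], rule exI[of _ "x - y"]) (simp add: xy algebra_simps)
qed

text \<open>Two consecutive convergents have errors of opposite sign. Coordinates \<open>x\<close>,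
  \<open>y\<close> of opposite sign therefore add up the errors, to at least
  \<open>\<theta> ^ (i + 1) + \<theta> ^ (i + 2) = \<theta> ^ i\<close>, while nonzero coordinates
  of equal sign make \<open>m\<close> too large or negative.\<close>

lemma best_approximation:
  fixes m p :: int
  assumes "0 < m" "m < int (fib (i + 3))"
  obtains "m = int (fib (i + 2))" "p = int (fib (i + 1))"
  | "m = int (fib (i + 1))" "p = int (fib i)"
  | "\<theta> ^ i \<le> \<bar>of_int m * \<theta> - of_int p\<bar>"
proof -
  obtain x y where m: "m = x * int (fib (i + 2)) + y * int (fib (i + 1))"
    and p: "p = x * int (fib (i + 1)) + y * int (fib i)"
    using fib_lattice[of m "Suc i" p] by auto
  have sum: "fib (i + 3) = fib (i + 2) + fib (i + 1)"
    by (simp add: numeral_3_eq_3)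
  have "of_int m * \<theta> - of_int p
      = of_int x * (real (fib (Suc (Suc i))) * \<theta> - real (fib (Suc i)))
        + of_int y * (real (fib (Suc i)) * \<theta> - real (fib i))"
    by (simp add: m p algebra_simps)
  also have "\<dots> = (- 1) ^ i * (of_int y * \<theta> ^ Suc i - of_int x * \<theta> ^ Suc (Suc i))"
    unfolding fib_mult_theta by (simp add: algebra_simps)
  finally have dist: "\<bar>of_int m * \<theta> - of_int p\<bar> = \<bar>of_int y * \<theta> ^ Suc i - of_int x * \<theta> ^ Suc (Suc i)\<bar>"
    by (simp add: abs_mult power_abs)
  have tpos: "0 < \<theta> ^ Suc i" "0 < \<theta> ^ Suc (Suc i)"
    by (rule theta_power_pos)+
  consider "x \<ge> 1" "y \<ge> 1" | "x \<le> 0" "y \<le> 0" | "x \<ge> 1" "y = 0" | "x = 0" "y = 1" | "x = 0" "y \<ge> 2"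
    | "x \<ge> 1" "y \<le> -1" | "x \<le> -1" "y \<ge> 1"
    by linarith
  then show thesis
  proof cases
    case 1
    then have "1 * int (fib (i + 2)) + 1 * int (fib (i + 1)) \<le> m"
      unfolding m by (intro add_mono mult_right_mono) auto
    with assms sum show ?thesis by simp
  next
    case 2
    then have "m \<le> 0"
      unfolding m by (simp add: add_nonpos_nonpos mult_nonpos_nonneg)
    with assms show ?thesis by simp
  next
    case 3
    have "x = 1"
    proof (rule ccontr)
      assume "x \<noteq> 1"
      with 3 have "2 * int (fib (i + 2)) \<le> x * int (fib (i + 2))"
        by (intro mult_right_mono) auto
      then have "2 * int (fib (i + 2)) \<le> m"
        using 3 by (simp only: m)
      moreover have "fib (i + 1) \<le> fib (i + 2)"
        by (simp add: fib_mono)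
      ultimately show False
        using assms sum by simp
    qed
    with 3 that(1) m p show ?thesis by simp
  next
    case 4
    with that(2) m p show ?thesis by simp
  next
    case 5
    \<comment> \<open>A double multiple of the second convergent is already far enough off because
      \<open>\<theta> > 1/2\<close>.\<close>
    have "\<theta> ^ i \<le> 2 * \<theta> ^ Suc i"
      using theta_bounds theta_power_pos[of i] by simp
    also have "\<dots> \<le> of_int y * \<theta> ^ Suc i"
      using 5 tpos(1) by (intro mult_right_mono) auto
    finally show ?thesis
      using that(3) 5 dist by simp
  next
    case 6
    then have "1 * \<theta> ^ Suc (Suc i) \<le> of_int x * \<theta> ^ Suc (Suc i)"
      "1 * \<theta> ^ Suc i \<le> - of_int y * \<theta> ^ Suc i"
      using tpos by (intro mult_right_mono; simp)+
    with dist theta_power_rec[of i] show ?thesis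
      by (intro that(3)) linarith
  next
    case 7
    then have "1 * \<theta> ^ Suc (Suc i) \<le> - of_int x * \<theta> ^ Suc (Suc i)"
      "1 * \<theta> ^ Suc i \<le> of_int y * \<theta> ^ Suc i"
      using tpos by (intro mult_right_mono; simp)+
    with dist theta_power_rec[of i] show ?thesis
      by (intro that(3)) linarith
  qed
qed

text \<open>This is \<open>best_approximation\<close> at index \<open>i - 2\<close>: even its two
  exceptional pairs have errors \<open>\<theta> ^ i\<close> and
  \<open>\<theta> ^ (i - 1)\<close>.\<close>

lemma theta_distance_ge:
  fixes m p :: int
  assumes "0 < m" "m < int (fib (Suc i))"
  shows "\<theta> ^ i \<le> \<bar>of_int m * \<theta> - of_int p\<bar>"
proof -
  \<comment> \<open>For \<open>i < 2\<close> the range of \<open>m\<close> is empty.\<close>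
  from assms have "i \<noteq> 0" "i \<noteq> 1" by (auto intro: ccontr)
  then obtain k where k: "i = Suc (Suc k)"
    by (metis One_nat_def not0_implies_Suc)
  have "m < int (fib (k + 3))"
    using assms by (simp add: k numeral_3_eq_3)
  with assms(1) show ?thesis
  proof (cases rule: best_approximation[of m k p])
    case 1
    with abs_fib_mult_theta[of "Suc k"] show ?thesis by (simp add: k)
  next
    case 2
    then show ?thesis
      using abs_fib_mult_theta[of k] theta_power_antimono[of "Suc k" i] by (simp add: k)
  next
    case 3
    then show ?thesis
      using theta_power_antimono[of k i] by (simp add: k)
  qed
qed

text \<open>Each \<open>m\<close> lies below some Fibonacci number, and
  \<open>theta_distance_ge\<close> then keeps \<open>m * \<theta>\<close> at a positive distance
  from the integers.\<close>

lemma theta_irrational: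
  fixes m p :: int
  assumes "0 < m"
  shows "of_int m * \<theta> \<noteq> of_int p"
proof -
  have "k \<le> fib (Suc (Suc k))" for k
  proof (induction k)
    case (Suc k)
    with Suc fib_pos_Suc[of k] show ?case by simp
  qed simp
  then have "nat m < fib (Suc (Suc (nat m + 1)))"
    by (meson less_add_one less_le_trans)
  then have "m < int (fib (Suc (Suc (nat m + 1))))"
    using assms by linarith
  from theta_distance_ge[OF assms this, of p] theta_power_pos show ?thesis
    by (metis abs_zero diff_self not_less)
qed

text \<open>The distance of \<open>q * \<theta>\<close> from the integers is at least the size of
  the shift \<open>e\<close>, so no integer is crossed. The last hypothesis excludes landing exactly
  on the next one.\<close>

lemma floor_add_small:
  fixes q :: int
  assumes "0 < q" "q < int (fib (Suc i))" "\<bar>e\<bar> \<le> \<theta> ^ i" "\<And>p. of_int q * \<theta> + e \<noteq> of_int p"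
  shows "\<lfloor>of_int q * \<theta> + e\<rfloor> = \<lfloor>of_int q * \<theta>\<rfloor>"
proof -
  let ?f = "\<lfloor>of_int q * \<theta>\<rfloor>"
  have "\<theta> ^ i \<le> \<bar>of_int q * \<theta> - of_int ?f\<bar>" "\<theta> ^ i \<le> \<bar>of_int q * \<theta> - of_int (?f + 1)\<bar>"
    using assms(1,2) by (intro theta_distance_ge; simp)+
  moreover have "of_int ?f \<le> of_int q * \<theta>" "of_int q * \<theta> < of_int ?f + 1"
    by linarith+
  ultimately have "of_int ?f \<le> of_int q * \<theta> + e" "of_int q * \<theta> + e \<le> of_int (?f + 1)"
    using assms(3) by auto
  moreover have "of_int q * \<theta> + e \<noteq> of_int (?f + 1)"
    using assms(4) by blast
  ultimately show ?thesis
    by (intro floor_unique) (auto simp: less_le)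
qed

section \<open>Letter counts of prefixes\<close>

lemma count_fib_word: "count_list (fib_word (Suc j)) a = fib (Suc j)"
  by (induction j rule: fib.induct) simp_all

text \<open>The word \<open>b\<close> of index 0 is not a prefix of the infinite Fibonacci word.\<close>
lemma count_take_fib_word:
  assumes "i \<le> length (fib_word (Suc j))"
  shows "int (count_list (take i (fib_word (Suc j))) a) = \<lfloor>real (Suc i) * \<theta>\<rfloor>"
  using assms
proof (induction j arbitrary: i rule: fib.induct)
  case 1
  then have "i = 0 \<or> i = 1" by auto
  moreover have "\<lfloor>\<theta>\<rfloor> = 0" "\<lfloor>2 * \<theta>\<rfloor> = 1"
    using theta_bounds by (auto intro!: floor_unique)
  ultimately show ?case by auto
next
  case 2
  then have "i = 0 \<or> i = 1 \<or> i = 2" by auto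
  moreover have "\<lfloor>\<theta>\<rfloor> = 0" "\<lfloor>2 * \<theta>\<rfloor> = 1" "\<lfloor>3 * \<theta>\<rfloor> = 1"
    using theta_bounds by (auto intro!: floor_unique)
  ultimately show ?case by (auto simp: numeral_2_eq_2)
next
  case (3 j)
  let ?l = "fib (Suc (Suc (Suc j)))"
  have len: "length (fib_word (Suc (Suc j))) = ?l" "length (fib_word (Suc j)) = fib (Suc (Suc j))"
    by (simp_all only: length_fib_word F_def)
  show ?case
  proof (cases "i \<le> ?l")
    case True
    then have "take i (fib_word (Suc (Suc (Suc j)))) = take i (fib_word (Suc (Suc j)))"
      using len by simp
    with 3(1)[of i] True len show ?thesis by simp
  next
    case False
    define k where "k = i - ?l"
    have i: "i = ?l + k" and k: "k \<le> fib (Suc (Suc j))"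
      using False 3(3) len by (simp_all add: k_def)
    have "take i (fib_word (Suc (Suc (Suc j)))) = fib_word (Suc (Suc j)) @ take k (fib_word (Suc j))"
      using len by (simp add: i)
    then have "int (count_list (take i (fib_word (Suc (Suc (Suc j))))) a)
        = int (fib (Suc (Suc j))) + \<lfloor>real (Suc k) * \<theta>\<rfloor>"
      using 3(2)[of k] k len count_fib_word[of "Suc j"] by (simp only: count_list_append of_nat_add)
    \<comment> \<open>Moving on by \<open>?l\<close> letters adds \<open>?l * \<theta>\<close>,
      which is so close to the integer \<open>fib (j + 2)\<close> that the floor changes by that
      integer only.\<close>
    also have "\<lfloor>real (Suc k) * \<theta>\<rfloor> = \<lfloor>real (Suc k) * \<theta> + (real ?l * \<theta> - real (fib (Suc (Suc j))))\<rfloor>"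
    proof -
      have "\<lfloor>of_int (int (Suc k)) * \<theta> + (real ?l * \<theta> - real (fib (Suc (Suc j))))\<rfloor>
          = \<lfloor>of_int (int (Suc k)) * \<theta>\<rfloor>"
      proof (rule floor_add_small)
        have "0 < fib (Suc j)" by (rule fib_pos_Suc)
        with k have "k < ?l" by simp
        then have "Suc k < fib (Suc (Suc (Suc (Suc j))))"
          using \<open>0 < fib (Suc j)\<close> by simp
        then show "int (Suc k) < int (fib (Suc (Suc (Suc (Suc j)))))"
          by linarith
        show "\<bar>real ?l * \<theta> - real (fib (Suc (Suc j)))\<bar> \<le> \<theta> ^ Suc (Suc (Suc j))"
          by (simp only: abs_fib_mult_theta)
      next
        fix p :: int
        \<comment> \<open>An exact hit would make a positive multiple of \<theta> an
          integer.\<close>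
        have "of_int (int (Suc k + ?l)) * \<theta> \<noteq> of_int (p + int (fib (Suc (Suc j))))"
          by (rule theta_irrational) simp
        then show "of_int (int (Suc k)) * \<theta> + (real ?l * \<theta> - real (fib (Suc (Suc j)))) \<noteq> of_int p"
          by (simp add: algebra_simps)
      qed simp
      then show ?thesis by simp
    qed
    also have "int (fib (Suc (Suc j))) + \<dots> = \<lfloor>real (Suc i) * \<theta>\<rfloor>"
      unfolding i by (simp only: int_add_floor) (simp add: algebra_simps)
    finally show ?thesis .
  qed
qed

section \<open>Decompositions expressed by prefix counts\<close>

lemma parikh_norm_parikh: "parikh_norm (parikh w) = length w"
proof (induction w)
  case (Cons x w)
  then show ?case by (cases x) (simp_all add: parikh_norm_def parikh_def)
qed (simp add: parikh_norm_def parikh_def)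

text \<open>Extracts the numerical data for the lower bound: head length \<open>h\<close>, number
  \<open>K\<close> of full blocks, and \<open>p\<close> letters \<open>a\<close> per block. Of the
  containments only the lengths of head and tail are kept.\<close>

lemma abelian_periodD:
  assumes "abelian_period w m"
  obtains h K p where "h < m" "1 \<le> K" "h + K * m \<le> length w" "length w < h + K * m + m"
    "count_list (take (h + K * m) w) a = count_list (take h w) a + K * p"
proof -
  obtain k u P where k: "2 \<le> k" and w: "w = concat (map u [0..<Suc k])"
    and P: "\<And>i. 1 \<le> i \<Longrightarrow> i \<le> k - 1 \<Longrightarrow> parikh (u i) = P" "parikh_norm P = m"
    and contained: "parikh_contained (parikh (u 0)) P" "parikh_contained (parikh (u k)) P"
    using assms unfolding abelian_period_def by fastforce
  define pre where "pre t = concat (map u [0..<Suc t])" for t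
  have pre_Suc: "pre (Suc t) = pre t @ u (Suc t)" for t
    by (simp add: pre_def)
  have pre: "length (pre t) = length (u 0) + t * m
      \<and> count_list (pre t) a = count_list (u 0) a + t * fst P" if "t \<le> k - 1" for t
    using that
  proof (induction t)
    case 0
    then show ?case by (simp add: pre_def)
  next
    case (Suc t)
    then have "parikh (u (Suc t)) = P"
      by (intro P) auto
    then have "length (u (Suc t)) = m" "count_list (u (Suc t)) a = fst P"
      using P(2) parikh_norm_parikh[of "u (Suc t)"] by (auto simp: parikh_def)
    with Suc show ?case by (simp add: pre_Suc)
  qed
  \<comment> \<open>Separating the full blocks from the head exhibits \<open>u 0\<close> as a prefix
    of \<open>w\<close>.\<close>
  define r where "r = concat (map u [1..<k])"
  have "[0..<k] = 0 # [1..<k]"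
    using k by (simp add: upt_conv_Cons)
  then have "pre (k - 1) = u 0 @ r"
    using k by (simp add: pre_def r_def)
  moreover have w_eq: "w = pre (k - 1) @ u k"
    using pre_Suc[of "k - 1"] k by (simp add: w pre_def)
  ultimately have w_eq2: "w = u 0 @ r @ u k"
    by simp
  have "take (length (u 0) + (k - 1) * m) w = pre (k - 1)"
    using pre[of "k - 1"] by (simp add: w_eq)
  moreover have "take (length (u 0)) w = u 0"
    by (simp add: w_eq2)
  moreover have "length (u 0) < m" "length (u k) < m"
    using contained P(2) by (auto simp: parikh_contained_def parikh_norm_parikh)
  ultimately show thesis
    using k pre[of "k - 1"] by (intro that[of "length (u 0)" "k - 1" "fst P"]) (auto simp: w_eq)
qed

text \<open>After the head, \<open>w\<close> is cut into as many blocks of length \<open>m\<close>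
  as fit. Differences of prefix counts at the cuts give the Parikh vectors of the blocks, and
  \<open>factors\<close> handles head and tail alike.\<close>

lemma abelian_periodI:
  assumes "p \<le> m" "h < m" "h + m \<le> length w"
    and blocks: "\<And>t. h + t * m \<le> length w \<Longrightarrow>
      count_list (take (h + t * m) w) a = count_list (take h w) a + t * p"
    and factors: "\<And>i r. r < m \<Longrightarrow> i + r \<le> length w \<Longrightarrow>
      parikh_contained (parikh (take r (drop i w))) (p, m - p)"
  shows "abelian_period w m"
proof -
  define K where "K = (length w - h) div m"
  have "0 < m" using assms by simp
  have "K * m \<le> length w - h"
    by (simp add: K_def)
  then have K: "h + K * m \<le> length w"
    using assms by linarith
  have "length w - h < K * m + m"
    using \<open>0 < m\<close> unfolding K_def by (metis div_mult_mod_eq add_strict_left_mono mod_less_divisor)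
  then have K': "length w < h + K * m + m"
    using assms by linarith
  have "1 \<le> K"
    using assms \<open>0 < m\<close> by (simp add: K_def div_greater_zero_iff Suc_le_eq)
  \<comment> \<open>At index \<open>K + 1\<close> fewer than \<open>m\<close> letters remain, so
    \<open>take m\<close> returns the tail.\<close>
  define u where "u i = (if i = 0 then take h w else take m (drop (h + (i - 1) * m) w))" for i
  have concat_u: "concat (map u [0..<Suc i]) = take (h + i * m) w" for i
  proof (induction i)
    case (Suc i)
    have "concat (map u [0..<Suc (Suc i)]) = take (h + i * m) w @ u (Suc i)"
      using Suc by simp
    also have "\<dots> = take (h + i * m + m) w"
      by (simp add: u_def take_add)
    finally show ?case by (simp add: algebra_simps)
  qed (simp add: u_def)
  have "w = concat (map u [0..<Suc (Suc K)])"
    unfolding concat_u using K' by simp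
  moreover have "parikh (u i) = (p, m - p)" if i: "i \<in> {1..K}" for i
  proof -
    from i obtain t where t: "i = Suc t" "Suc t \<le> K"
      by (cases i) auto
    have "Suc t * m \<le> K * m"
      using t by (intro mult_right_mono) auto
    then have le: "h + Suc t * m \<le> length w"
      using K by linarith
    then have le': "h + t * m \<le> length w" by simp
    have "take (h + Suc t * m) w = take (h + t * m) w @ u i"
      by (simp add: u_def t take_add[symmetric] add_ac)
    with blocks[OF le] blocks[OF le'] have "count_list (u i) a = p"
      by simp
    moreover have "length (u i) = m"
      using le by (simp add: u_def t)
    ultimately show ?thesis
      using parikh_norm_parikh[of "u i"] by (simp add: parikh_norm_def parikh_def)
  qed
  moreover have "parikh_contained (parikh (u 0)) (p, m - p)"
    using factors[of h 0] assms by (simp add: u_def)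
  moreover have "parikh_contained (parikh (u (Suc K))) (p, m - p)"
  proof -
    have "u (Suc K) = take (length w - (h + K * m)) (drop (h + K * m) w)"
      using K' by (simp add: u_def)
    also have "parikh_contained (parikh \<dots>) (p, m - p)"
      using K K' by (intro factors) auto
    finally show ?thesis .
  qed
  moreover have "parikh_norm (p, m - p) = m"
    using assms by (simp add: parikh_norm_def)
  ultimately show ?thesis
    unfolding abelian_period_def using \<open>1 \<le> K\<close>
    by (intro exI[of _ "Suc K"] exI[of _ u] exI[of _ "(p, m - p)"]) auto
qed

section \<open>Lower bound for abelian periods\<close>

text \<open>Here \<open>i = n - 2\<close>, so the bound on \<open>m\<close> is \<open>F n\<close>,
  and \<open>N\<close> says that \<open>j\<close> is at least \<open>2 * n\<close>, or equals
  \<open>2 * n - 1\<close> with \<open>n\<close> even. The number of blocks forced by the length is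
  played off against the number allowed by the error per block.\<close>

lemma no_small_abelian_period:
  assumes N: "2 * i + 4 \<le> j \<or> j = 2 * i + 3 \<and> even i"
    and m: "m < fib (i + 3)"
  shows "\<not> abelian_period (fib_word j) m"
proof
  assume "abelian_period (fib_word j) m"
  then obtain h K p where hK: "h < m" "h + K * m \<le> length (fib_word j)"
      "length (fib_word j) < h + K * m + m"
    and count: "count_list (take (h + K * m) (fib_word j)) a
      = count_list (take h (fib_word j)) a + K * p"
    by (rule abelian_periodD)
  obtain j' where j': "j = Suc j'"
    using N by (cases j) auto
  define u v where "u = fib (i + 2)" and "v = fib (i + 1)"
  have uv: "0 < u" "0 < v" "v \<le> u"
    using fib_pos_Suc[of i] fib_pos_Suc[of "Suc i"] by (simp_all add: u_def v_def)
  have fib3: "fib (i + 3) = u + v" and fib4: "fib (i + 4) = 2 * u + v"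
    by (simp_all add: u_def v_def eval_nat_numeral)
  \<comment> \<open>Head and tail have at most \<open>m - 1\<close> letters each, whence the summand
    2 in \<open>len\<close>.\<close>
  have "h + K * m + m + 1 \<le> (K + 2) * m"
    using hK by (simp add: algebra_simps)
  then have len: "F j + 2 \<le> (K + 2) * m"
    using hK unfolding length_fib_word by linarith
  have "fib (2 * i + 4) \<le> F j"
    unfolding F_def using N by (intro fib_mono) auto
  moreover have "fib (2 * i + 4) = (u + v) * u + u * v"
    using fib_add[of "i + 1" "i + 2"] fib3 by (simp add: u_def v_def eval_nat_numeral)
  ultimately have Fj: "u * u + 2 * (u * v) \<le> F j"
    by (simp add: algebra_simps)
  define \<delta> where "\<delta> = real m * \<theta> - real p"
  have "\<lfloor>real (Suc (h + K * m)) * \<theta>\<rfloor> = \<lfloor>real (Suc h) * \<theta>\<rfloor> + int (K * p)"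
    using count hK count_take_fib_word[of "h + K * m" j'] count_take_fib_word[of h j']
    unfolding j' by simp
  moreover have "real (Suc (h + K * m)) * \<theta> = (real (Suc h) * \<theta> + real K * \<delta>) + real_of_int (int (K * p))"
    by (simp add: \<delta>_def algebra_simps)
  \<comment> \<open>The accumulated error \<open>K * \<delta>\<close> must not carry the starting
    point \<open>(h + 1) * \<theta>\<close> across an integer.\<close>
  ultimately have floor_eq: "\<lfloor>real (Suc h) * \<theta> + real K * \<delta>\<rfloor> = \<lfloor>real (Suc h) * \<theta>\<rfloor>"
    using floor_add_int by (metis add_right_cancel)
  have "\<bar>real K * \<delta>\<bar> < 1"
    using floor_eq by linarith
  then have close: "real K * \<bar>\<delta>\<bar> < 1"
    by (simp add: abs_mult)
  have K_less: "K < fib (Suc (Suc l))" if "\<theta> ^ l \<le> \<bar>\<delta>\<bar>" for l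
  proof -
    have "real K * \<theta> ^ l \<le> real K * \<bar>\<delta>\<bar>"
      using that by (intro mult_left_mono) auto
    also note close
    also note fib_theta_power_ge[of l]
    finally show ?thesis
      using theta_power_pos[of l] by simp
  qed
  have "0 < int m" "int m < int (fib (i + 3))"
    using hK m by auto
  then show False
  proof (cases rule: best_approximation[of "int m" i "int p"])
    case 1
    then have mp: "m = u" "p = v"
      by (simp_all add: u_def v_def)
    have \<delta>: "\<delta> = (- 1) ^ Suc i * \<theta> ^ Suc (Suc i)"
      using fib_mult_theta[of "Suc i"] by (simp add: \<delta>_def mp u_def v_def)
    \<comment> \<open>Since \<open>h < m\<close>, the multiplier \<open>h + 1\<close> is still below
      \<open>fib (i + 3)\<close>.\<close>
    have dist: "\<theta> ^ Suc (Suc i) \<le> \<bar>real (Suc h) * \<theta> - of_int z\<bar>" for z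
      using theta_distance_ge[of "int (Suc h)" "Suc (Suc i)" z] hK m by (simp add: numeral_3_eq_3)
    define f where "f = \<lfloor>real (Suc h) * \<theta>\<rfloor>"
    have f: "of_int f \<le> real (Suc h) * \<theta>" "real (Suc h) * \<theta> < of_int f + 1"
      "of_int f \<le> real (Suc h) * \<theta> + real K * \<delta>" "real (Suc h) * \<theta> + real K * \<delta> < of_int f + 1"
      using floor_eq unfolding f_def by linarith+
    \<comment> \<open>The drift moves away from one of the two neighbouring integers, from which the
      start is already \<open>\<theta> ^ (i + 2)\<close> distant. The start thus costs as much room
      as one more block.\<close>
    have K: "real (K + 1) * \<theta> ^ Suc (Suc i) \<le> 1"
    proof (cases "even i")
      case True
      then have "\<delta> = - (\<theta> ^ Suc (Suc i))"
        by (simp add: \<delta>)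
      with f dist[of "f + 1"] show ?thesis
        by (simp add: algebra_simps)
    next
      case False
      then have "\<delta> = \<theta> ^ Suc (Suc i)"
        by (simp add: \<delta>)
      with f dist[of f] show ?thesis
        by (simp add: algebra_simps)
    qed
    from N show False
    proof
      assume "2 * i + 4 \<le> j"
      then have "fib (2 * i + 5) \<le> F j"
        unfolding F_def by (intro fib_mono) auto
      moreover have "fib (2 * i + 5) = (u + v) * (u + v) + u * u"
        using fib_add[of "i + 2" "i + 2"] fib3 by (simp add: u_def eval_nat_numeral)
      ultimately have "(u + v) * (u + v) + u * u + 2 \<le> (K + 2) * u"
        using len mp by simp
      \<comment> \<open>For \<open>j\<close> this large the crude estimate of
        \<open>1 / \<theta> ^ (i + 2)\<close> by \<open>fib (i + 4)\<close> suffices.\<close>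
      moreover have "K + 1 \<le> 2 * u + v"
      proof -
        have "fib (Suc (Suc (Suc (Suc i)))) = 2 * u + v"
          using fib4 by (simp add: eval_nat_numeral)
        then have "1 \<le> real (2 * u + v) * \<theta> ^ Suc (Suc i)"
          using fib_theta_power_ge[of "Suc (Suc i)"] by metis
        with K have "real (K + 1) * \<theta> ^ Suc (Suc i) \<le> real (2 * u + v) * \<theta> ^ Suc (Suc i)"
          by linarith
        then show ?thesis
          using theta_power_pos[of "Suc (Suc i)"] by (simp only: mult_le_cancel_right_pos of_nat_le_iff)
      qed
      then have "(K + 2) * u \<le> (2 * u + v + 1) * u"
        by (intro mult_right_mono) auto
      moreover have "u * 1 \<le> u * v"
        using uv by (intro mult_left_mono) auto
      ultimately show False
        by (simp add: algebra_simps)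
    next
      assume "j = 2 * i + 3 \<and> even i"
      then have "even i" by simp
      \<comment> \<open>The factor \<open>u + 2 * v\<close> is the Lucas number
        \<open>L (i + 2)\<close>. For even \<open>i\<close> it exceeds
        \<open>1 / \<theta> ^ (i + 2)\<close>, by an amount invisible to the crude estimate.\<close>
      have "(u + 2 * v) * u < (K + 2) * u"
        using len Fj mp by (simp add: algebra_simps)
      then have "u + 2 * v \<le> K + 1"
        by (simp only: mult_less_cancel2) simp
      then have "real (u + 2 * v) * \<theta> ^ Suc (Suc i) \<le> real (K + 1) * \<theta> ^ Suc (Suc i)"
        using theta_power_pos[of "Suc (Suc i)"] by (intro mult_right_mono) (simp_all only: of_nat_le_iff less_imp_le)
      moreover have "real (u + 2 * v) * \<theta> ^ Suc (Suc i) = 1 + (\<theta> ^ Suc (Suc i)) ^ 2"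
        using lucas_theta_power[of "Suc i"] \<open>even i\<close> by (simp add: u_def v_def add_ac)
      moreover have "0 < (\<theta> ^ Suc (Suc i)) ^ 2"
        using theta_bounds by simp
      ultimately show False
        using K by linarith
    qed
  next
    case 2
    then have mp: "m = v" "p = fib i"
      by (simp_all add: v_def)
    have "\<bar>\<delta>\<bar> = \<theta> ^ Suc i"
      using abs_fib_mult_theta[of i] by (simp add: \<delta>_def mp v_def)
    then have "K < u + v"
      using K_less[of "Suc i"] fib3 by (simp add: eval_nat_numeral)
    then have "(K + 2) * v \<le> (u + v + 1) * v"
      by (intro mult_right_mono) auto
    then have "F j + 2 \<le> u * v + v * v + v"
      using len mp by (simp add: algebra_simps)
    moreover have "v * 1 \<le> u * u" "v * v \<le> u * v"
      using uv by (intro mult_mono; simp)+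
    ultimately show False
      using Fj by linarith
  next
    case 3
    then have "K < u"
      using K_less[of i] by (simp add: \<delta>_def u_def)
    then have "(K + 2) * m \<le> (u + 1) * m"
      by (intro mult_right_mono) auto
    \<comment> \<open>Strictness of \<open>m < u + v\<close> saves a summand
      \<open>u + 1\<close>.\<close>
    moreover have "(u + 1) * (m + 1) \<le> (u + 1) * (u + v)"
      using m fib3 by (intro mult_left_mono) auto
    ultimately have "F j + 2 \<le> u * u + u * v + v"
      using len by (simp add: algebra_simps)
    moreover have "1 * v \<le> u * v"
      using uv by (intro mult_mono) auto
    ultimately show False
      using Fj by linarith
  qed
qed

section \<open>The period \<open>F n\<close> is attained\<close>

text \<open>Again \<open>i = n - 2\<close>. A head of length \<open>w - 1\<close> starts the blocks
  at \<open>w * \<theta> = u + \<delta>\<close>, on the side of the integer \<open>u\<close> towards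
  which the drift moves, so nearly a whole unit is available.\<close>

lemma fib_is_abelian_period:
  assumes N: "2 * i + 3 \<le> j" "j \<le> 2 * i + 4 \<or> j = 2 * i + 5 \<and> even i"
  shows "abelian_period (fib_word j) (fib (i + 3))"
proof -
  obtain j' where j': "j = Suc j'"
    using N by (cases j) auto
  define u v w where "u = fib (i + 2)" and "v = fib (i + 1)" and "w = fib (i + 3)"
  have uv: "0 < u" "0 < v" "v \<le> u"
    using fib_pos_Suc[of i] fib_pos_Suc[of "Suc i"] by (simp_all add: u_def v_def)
  have w: "w = u + v" and fib4: "fib (i + 4) = w + u"
    by (simp_all add: u_def v_def w_def eval_nat_numeral)
  define \<delta> where "\<delta> = real w * \<theta> - real u"
  have \<delta>: "\<delta> = (- 1) ^ i * \<theta> ^ (i + 3)"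
    using fib_mult_theta[of "i + 2"] by (simp add: \<delta>_def u_def w_def eval_nat_numeral)
  have few_blocks: "real (t + 1) * \<theta> ^ (i + 3) < 1" if "w - 1 + t * w \<le> length (fib_word j)" for t
  proof -
    have t: "(t + 1) * w \<le> F j + 1"
      using that uv w by (simp add: length_fib_word)
    from N(2) show ?thesis
    proof
      assume "j \<le> 2 * i + 4"
      then have "F j \<le> fib (2 * i + 5)"
        unfolding F_def by (intro fib_mono) auto
      also have "\<dots> = w * w + u * u"
        using fib_add[of "i + 2" "i + 2"] by (simp add: u_def w_def eval_nat_numeral)
      \<comment> \<open>This caps \<open>t + 1\<close> by \<open>fib (i + 4)\<close>, which is below
        \<open>1 / \<theta> ^ (i + 3)\<close>.\<close>
      also have "\<dots> + 1 \<le> (w + u) * w"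
        using uv by (simp add: w algebra_simps Suc_le_eq)
      finally have "(t + 1) * w \<le> (w + u) * w"
        using t by simp
      then have "t + 1 \<le> w + u"
        using uv w by (simp only: mult_le_cancel2)
      then have "real (t + 1) * \<theta> ^ (i + 3) \<le> real (w + u) * \<theta> ^ (i + 3)"
        using theta_power_pos[of "i + 3"] by (intro mult_right_mono) (simp_all only: of_nat_le_iff less_imp_le)
      also have "\<dots> < 1"
      proof -
        have "fib (Suc (i + 3)) = w + u"
          using fib4 by (simp add: eval_nat_numeral)
        then show ?thesis
          using fib_theta_power_less[of "i + 3"] by simp
      qed
      finally show ?thesis .
    next
      assume j: "j = 2 * i + 5 \<and> even i"
      \<comment> \<open>The factor \<open>w + 2 * u\<close> is the Lucas number
        \<open>L (i + 3)\<close>; evenness of \<open>i\<close> puts it just below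
        \<open>1 / \<theta> ^ (i + 3)\<close>.\<close>
      have "F j = (w + 2 * u) * w"
        using fib_add[of "i + 2" "i + 3"] fib4 j by (simp add: F_def u_def w_def eval_nat_numeral algebra_simps)
      with t have "(t + 1) * w < (w + 2 * u + 1) * w"
        using uv w by (simp add: algebra_simps)
      then have "t + 1 \<le> w + 2 * u"
        by simp
      then have "real (t + 1) * \<theta> ^ (i + 3) \<le> real (w + 2 * u) * \<theta> ^ (i + 3)"
        using theta_power_pos[of "i + 3"] by (intro mult_right_mono) (simp_all only: of_nat_le_iff less_imp_le)
      also have "\<dots> = 1 - (\<theta> ^ (i + 3)) ^ 2"
      proof -
        have "fib (i + 2) + fib (Suc (Suc (i + 2))) = w + 2 * u"
          using fib4 by (simp add: u_def eval_nat_numeral)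
        then show ?thesis
          using lucas_theta_power[of "i + 2"] j by (simp add: eval_nat_numeral)
      qed
      also have "\<dots> < 1"
        using theta_bounds by simp
      finally show ?thesis .
    qed
  qed
  have "abelian_period (fib_word j) w"
  proof (rule abelian_periodI)
    show "u \<le> w" "w - 1 < w"
      using uv w by auto
    show "w - 1 + w \<le> length (fib_word j)"
    \<comment> \<open>The bound \<open>i + 5 \<le> j + 1\<close> follows from
      \<open>2 * i + 3 \<le> j\<close> only for positive \<open>i\<close>.\<close>
    proof (cases "i = 0")
      case True
      then have "fib 4 \<le> F j"
        using N unfolding F_def by (intro fib_mono) auto
      with True show ?thesis
        by (simp add: w_def length_fib_word eval_nat_numeral)
    next
      case False
      then have "fib (i + 5) \<le> F j"
        using N unfolding F_def by (intro fib_mono) auto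
      moreover have "fib (i + 5) = w + u + w"
        using fib4 by (simp add: w_def eval_nat_numeral)
      ultimately show ?thesis
        by (simp add: length_fib_word)
    qed
  next
    fix t
    assume t: "w - 1 + t * w \<le> length (fib_word j)"
    \<comment> \<open>The fractional drift has a fixed sign and stays below 1, so the floor has the
      same offset from \<open>(s + 1) * u\<close> after every block. The instance
      \<open>s = 0\<close> is the head.\<close>
    have floor_mult: "\<lfloor>real (s + 1) * (real w * \<theta>)\<rfloor> = int ((s + 1) * u) + (if even i then 0 else - 1)"
      if "s \<le> t" for s
    proof -
      have "real (s + 1) * \<theta> ^ (i + 3) \<le> real (t + 1) * \<theta> ^ (i + 3)"
        using theta_power_pos[of "i + 3"] that by (intro mult_right_mono) auto
      with few_blocks[OF t] have "real (s + 1) * \<theta> ^ (i + 3) < 1"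
        by linarith
      moreover have "0 < real (s + 1) * \<theta> ^ (i + 3)"
        using theta_power_pos[of "i + 3"] by simp
      moreover have "real (s + 1) * (real w * \<theta>)
          = real ((s + 1) * u) + (- 1) ^ i * (real (s + 1) * \<theta> ^ (i + 3))"
        using \<delta> by (simp add: \<delta>_def algebra_simps)
      ultimately show ?thesis
        by (intro floor_unique) (auto simp del: of_nat_mult of_nat_add of_nat_Suc)
    qed
    have "int (count_list (take (w - 1 + t * w) (fib_word j)) a) = \<lfloor>real (t + 1) * (real w * \<theta>)\<rfloor>"
    proof -
      have "real (Suc (w - 1 + t * w)) = real (t + 1) * real w"
        using uv w by (simp add: algebra_simps of_nat_diff)
      then show ?thesis
        using count_take_fib_word[of "w - 1 + t * w" j'] t j' by (simp add: mult.assoc)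
    qed
    moreover have "int (count_list (take (w - 1) (fib_word j)) a) = \<lfloor>real (0 + 1) * (real w * \<theta>)\<rfloor>"
      using count_take_fib_word[of "w - 1" j'] t j' uv w by simp
    ultimately have "int (count_list (take (w - 1 + t * w) (fib_word j)) a)
        = int (count_list (take (w - 1) (fib_word j)) a + t * u)"
      using floor_mult[of t] floor_mult[of 0] by simp
    then show "count_list (take (w - 1 + t * w) (fib_word j)) a
        = count_list (take (w - 1) (fib_word j)) a + t * u"
      by linarith
  next
    fix k r
    assume r: "r < w" "k + r \<le> length (fib_word j)"
    define x where "x = take r (drop k (fib_word j))"
    have "count_list (take (k + r) (fib_word j)) a = count_list (take k (fib_word j)) a + count_list x a"
      by (simp add: take_add x_def)
    then have "int (count_list x a) = \<lfloor>real (Suc (k + r)) * \<theta>\<rfloor> - \<lfloor>real (Suc k) * \<theta>\<rfloor>"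
      using count_take_fib_word[of "k + r" j'] count_take_fib_word[of k j'] r j' by simp
    moreover have "real (Suc (k + r)) * \<theta> = real (Suc k) * \<theta> + real r * \<theta>"
      by (simp add: algebra_simps)
    ultimately have c: "real (count_list x a) < real r * \<theta> + 1" "real r * \<theta> < real (count_list x a) + 1"
      by linarith+
    have len: "length x = r"
      using r by (simp add: x_def)
    then have total: "count_list x a + count_list x b = r"
      using parikh_norm_parikh[of x] by (simp add: parikh_norm_def parikh_def)
    \<comment> \<open>With \<open>\<bar>\<delta>\<bar>\<close> at most
      \<open>2 * \<theta> - 1\<close>, the number of \<open>a\<close> is below
      \<open>u + \<theta>\<close> and that of \<open>b\<close> below
      \<open>w - u + 3 * \<theta> - 1\<close>; the latter is where \<open>\<theta> < 2/3\<close>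
      enters.\<close>
    have "\<bar>\<delta>\<bar> = \<theta> ^ (i + 3)"
      unfolding \<delta> abs_mult power_abs using theta_bounds by simp
    also have "\<dots> \<le> \<theta> ^ 3"
      by (intro theta_power_antimono) simp
    also have "\<dots> = 2 * \<theta> - 1"
      using theta_power_rec[of 0] theta_power_rec[of 1] by (simp add: eval_nat_numeral)
    finally have "\<bar>\<delta>\<bar> \<le> 2 * \<theta> - 1" .
    have "real r \<le> real w - 1"
      using r by linarith
    then have "real r * \<theta> \<le> (real w - 1) * \<theta>" "real r * (1 - \<theta>) \<le> (real w - 1) * (1 - \<theta>)"
      using theta_bounds by (intro mult_right_mono; simp)+
    then have "real r * \<theta> \<le> real u + \<delta> - \<theta>" "real r - real r * \<theta> \<le> real w - real u - \<delta> - 1 + \<theta>"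
      by (simp_all add: \<delta>_def algebra_simps)
    with c \<open>\<bar>\<delta>\<bar> \<le> 2 * \<theta> - 1\<close> theta_bounds
    have "real (count_list x a) < real u + 1" "real r - real (count_list x a) < real w - real u + 1"
      by linarith+
    then have "count_list x a \<le> u" "count_list x b \<le> w - u"
      using total by linarith+
    then show "parikh_contained (parikh (take r (drop k (fib_word j)))) (u, w - u)"
      using r len w parikh_norm_parikh[of x]
      unfolding x_def[symmetric] by (simp add: parikh_contained_def parikh_norm_def parikh_def)
  qed
  then show ?thesis
    by (simp add: w_def)
qed

theorem theorem6p12:
  fixes j n :: nat
  assumes "j \<ge> 3"
    and "j mod 4 \<in> {0, 1, 2} \<Longrightarrow> n = j div 2"
    and "j mod 4 = 3 \<Longrightarrow> n = j div 2 + 1"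
  shows "is_min_abelian_period (fib_word j) (F n)"
proof -
  have "j mod 4 \<in> {0, 1, 2} \<or> j mod 4 = 3"
    using mod_less_divisor[of 4 j] by auto
  with assms have "n = j div 2 \<and> j mod 4 \<noteq> 3 \<or> n = j div 2 + 1 \<and> j mod 4 = 3"
    by auto
  \<comment> \<open>The rule modulo 4 says that \<open>j\<close> is \<open>2 * n\<close>, or one of
    \<open>2 * n - 1\<close> and \<open>2 * n + 1\<close> with \<open>n\<close> even. Parity carries
    over to \<open>i = n - 2\<close>.\<close>
  then have n: "2 \<le> n" "2 * n \<le> j + 1" "j \<le> 2 * n \<or> j = 2 * n + 1 \<and> even n" "2 * n \<le> j \<or> j + 1 = 2 * n \<and> even n"
    using assms(1) by presburger+
  then obtain i where i: "n = i + 2"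
    by (metis add.commute le_iff_add)
  have "abelian_period (fib_word j) (fib (i + 3))"
    using n i by (intro fib_is_abelian_period) auto
  moreover have "\<not> abelian_period (fib_word j) m" if "m < fib (i + 3)" for m
    using n i that by (intro no_small_abelian_period) auto
  moreover have "F n = fib (i + 3)"
    by (simp add: F_def i eval_nat_numeral)
  ultimately show ?thesis
    unfolding is_min_abelian_period_def by (metis not_less)
qed

end
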